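(* Let $\mathcal{P} = \operatorname{conv}(v_0,\ldots,v_n) \subseteq \mathbb{R}^n$ and $\mathcal{Q} = \operatorname{conv}(w_0,\ldots,w_m) \subseteq \mathbb{R}^m$ be full-dimensional reflexive lattice simplices (each containing the origin in its interior) of types $((p_0,\ldots,p_n),\lambda)$ and $((q_0,\ldots,q_m),\mu)$ respectively, where $p_j$ is associated with vertex $v_j$ and $q_k$ with vertex $w_k$. Fix $i \in \{0,\ldots,m\}$ and let $$\mathcal{P} *_i \mathcal{Q} := \operatorname{conv}\big((\mathcal{P} \times \{0\}^m) \cup (\{0\}^n \times (\mathcal{Q} - w_i))\big) \subseteq \mathbb{R}^{n+m}.$$ Then $\mathcal{P} *_i \mathcal{Q}$ is a reflexive simplex of type $$\left(\frac{1}{d}\big(q_ip_0,q_ip_1,\ldots,q_ip_n,sq_0,sq_1,\ldots,\widehat{sq_i},\ldots,sq_m\big),\ d\right),$$ where $s = \sum_{j=0}^n p_j$, $d = \gcd\big(q_i, \sum_{j=0}^n p_j\big)$, and the hat indicates that the entry $sq_i$ is omitted.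
   Context: A lattice polytope $\mathcal{P}$ is reflexive if $0$ lies in its interior and its polar dual $\mathcal{P}^{\Delta} := \{y : x \cdot y \le 1 \text{ for all } x \in \mathcal{P}\}$ is also a lattice polytope; a lattice translate of a reflexive polytope is also called reflexive. Type of a reflexive simplex: let $\mathcal{S}\subseteq\mathbb{R}^n$ be an $n$-dimensional reflexive simplex with the origin in its interior and vertices $u_0,\ldots,u_n$. Set $q_i = |\det(u_0,\ldots,\widehat{u_i},\ldots,u_n)|$ (the absolute value of the determinant of the $n\times n$ matrix whose columns are all vertices except $u_i$), $Q=(q_0,\ldots,q_n)$, $\lambda=\gcd(q_0,\ldots,q_n)$ and $Q_{red} = \frac{1}{\lambda}Q$. The type of $\mathcal{S}$ is $(Q_{red},\lambda)$, where the vector $Q_{red}$ is considered only up to reordering of its entries (reordering corresponds to relabeling the vertices, and one usually lists it in nondecreasing order).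
   Formalization: The second component of the type of P *_i Q is proved to be λμd instead of d; the printed value d is wrong whenever λμ > 1 (e.g. P = conv((-1,-1),(2,-1),(-1,2)), Q = [-1,1], w_i = -1 gives 3, not 1). *)

theory Defs
  imports "HOL-Analysis.Analysis" "HOL-Library.Multiset"
begin

definition lattice_point :: "real ^ 'n \<Rightarrow> bool" where
  "lattice_point x \<longleftrightarrow> (\<forall>r. x $ r \<in> \<int>)"

definition lattice_polytope :: "(real ^ 'n) set \<Rightarrow> bool" where
  "lattice_polytope P \<longleftrightarrow> (\<exists>V. finite V \<and> (\<forall>x\<in>V. lattice_point x) \<and> P = convex hull V)"

definition polar_dual :: "(real ^ 'n) set \<Rightarrow> (real ^ 'n) set" where
  "polar_dual P = {y. \<forall>x\<in>P. x \<bullet> y \<le> 1}"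

definition origin_reflexive :: "(real ^ 'n) set \<Rightarrow> bool" where
  "origin_reflexive P \<longleftrightarrow>
     lattice_polytope P \<and> 0 \<in> interior P \<and> lattice_polytope (polar_dual P)"

definition reflexive :: "(real ^ 'n) set \<Rightarrow> bool" where
  "reflexive P \<longleftrightarrow> (\<exists>t. lattice_point t \<and> origin_reflexive ((+) t ` P))"

text \<open>
  The \<open>n + 1\<close> vertices of an \<open>n\<close>-dimensional simplex are labelled by \<open>'n option\<close>.
\<close>

definition origin_reflexive_simplex :: "('n option \<Rightarrow> real ^ 'n) \<Rightarrow> bool" where
  "origin_reflexive_simplex u \<longleftrightarrow>
     inj u \<and> \<not> affine_dependent (range u) \<and> origin_reflexive (convex hull (range u))"

text \<open>
  The columns of the matrix are all the vertices except \<open>u i\<close>; if \<open>i = Some c\<close>, the vertex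
  \<open>u None\<close> takes the free place \<open>c\<close>. The order of the columns does not affect the absolute value.
  The floor only changes the type: the determinant is an integer when the vertices are
  lattice points.
\<close>

definition weight :: "('n option \<Rightarrow> real ^ 'n) \<Rightarrow> 'n option \<Rightarrow> nat" where
  "weight u i = nat \<lfloor>\<bar>det (\<chi> r c. (if Some c = i then u None else u (Some c)) $ r)\<bar>\<rfloor>"

definition weight_gcd :: "('n option \<Rightarrow> real ^ 'n) \<Rightarrow> nat" where
  "weight_gcd u = Gcd (range (weight u))"

definition reduced_weight :: "('n option \<Rightarrow> real ^ 'n) \<Rightarrow> 'n option \<Rightarrow> nat" where
  "reduced_weight u i = weight u i div weight_gcd u"

text \<open>
  The type of a reflexive simplex \<open>S\<close>, given as a set. As \<open>S\<close> need only be a lattice translate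
  of a simplex with the origin in its interior, the type is read off that translate, which is
  unique because a reflexive polytope has just one interior lattice point. The multiset expresses
  that the reduced weights are considered up to reordering.
\<close>

definition has_type :: "(real ^ 'n) set \<Rightarrow> nat multiset \<Rightarrow> nat \<Rightarrow> bool" where
  "has_type S M l \<longleftrightarrow>
     (\<exists>t u. lattice_point t \<and> (+) t ` S = convex hull (range u) \<and> origin_reflexive_simplex u \<and>
        M = image_mset (reduced_weight u) (mset_set UNIV) \<and> l = weight_gcd u)"

definition pair_vec :: "real ^ 'n \<Rightarrow> real ^ 'm \<Rightarrow> real ^ ('n + 'm)" where
  "pair_vec x y = (\<chi> k. case k of Inl a \<Rightarrow> x $ a | Inr b \<Rightarrow> y $ b)"

text \<open>With \<open>z = w i\<close> this is the operation written \<open>P *\<^sub>i Q\<close>.\<close>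

definition join_at :: "real ^ 'm \<Rightarrow> (real ^ 'n) set \<Rightarrow> (real ^ 'm) set \<Rightarrow> (real ^ ('n + 'm)) set" where
  "join_at z P Q =
     convex hull ((\<lambda>x. pair_vec x 0) ` P \<union> (\<lambda>y. pair_vec 0 (y - z)) ` Q)"

end

theory Submission
  imports Defs
begin

text \<open>
  Translating \<open>P *\<^sub>i Q\<close> by \<open>(0, w\<^sub>i)\<close> gives the simplex with the vertices \<open>(v\<^sub>j, w\<^sub>i)\<close> and
  \<open>(0, w\<^sub>k)\<close> for \<open>k \<noteq> i\<close>; the vertex \<open>(0, 0)\<close> of \<open>{0} \<times> (Q - w\<^sub>i)\<close> disappears in the interior of \<open>P\<close>.
  By Cramer's rule the weights of a simplex are proportional to the coefficients of the linear
  relation among its vertices, so combining \<open>\<Sum> p\<^sub>j v\<^sub>j = 0\<close> and \<open>\<Sum> q\<^sub>k w\<^sub>k = 0\<close> to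
  \<open>\<Sum> q\<^sub>i p\<^sub>j (v\<^sub>j, w\<^sub>i) + \<Sum> s q\<^sub>k (0, w\<^sub>k) = 0\<close> determines the new weights up to a common factor, and one
  block triangular determinant shows that this factor is \<open>\<lambda> \<mu>\<close>. A simplex with
  lattice vertices and the origin in its interior is reflexive iff every facet lies on a hyperplane
  \<open>y \<bullet> x = 1\<close> with \<open>y\<close> a lattice point. If \<open>a\<^sub>j\<close> and \<open>b\<^sub>k\<close> are these normals for \<open>P\<close> and \<open>Q\<close>, those of
  the join are \<open>((1 - b\<^sub>i \<bullet> w\<^sub>i) a\<^sub>j, b\<^sub>i)\<close> and \<open>(0, b\<^sub>k)\<close>.
\<close>

subsection \<open>Block triangular determinants\<close>

lemma sign_transpose_comp:
  fixes p :: "'a::finite \<Rightarrow> 'a"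
  assumes "p permutes UNIV" "a \<noteq> b"
  shows "sign (Transposition.transpose a b \<circ> p) = - sign p"
  using assms permutes_imp_permutation[OF finite assms(1)]
  by (simp add: sign_compose permutation_swap_id sign_swap_id)

lemma map_sum_permutes:
  assumes "p permutes UNIV" "r permutes UNIV"
  shows "map_sum p r permutes UNIV"
proof (rule bij_imp_permutes)
  show "bij (map_sum p r)"
    by (rule o_bij[of "map_sum (inv p) (inv r)"])
      (simp_all only: map_sum.comp permutes_inv_o[OF assms(1)] permutes_inv_o[OF assms(2)] map_sum.id)
qed simp

text \<open>A transposition on one summand is a transposition of the sum type, so induction over
  transpositions applies to \<open>r\<close> with \<open>p\<close> fixed, and to \<open>p\<close>
  with \<open>id\<close> in place of \<open>r\<close>.\<close>

lemma sign_map_sum: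
  fixes p :: "'a::finite \<Rightarrow> 'a" and r :: "'b::finite \<Rightarrow> 'b"
  assumes "p permutes UNIV" "r permutes UNIV"
  shows "sign (map_sum p r) = sign p * sign r"
proof -
  have left: "sign (map_sum p (id :: 'b \<Rightarrow> 'b)) = sign p"
    using assms(1) finite
  proof (induction rule: permutes_induct)
    case (swap a b p)
    have "map_sum (Transposition.transpose a b \<circ> p) (id :: 'b \<Rightarrow> 'b) k
        = (Transposition.transpose (Inl a) (Inl b) \<circ> map_sum p id) k" for k
      by (cases k) (auto simp: Transposition.transpose_def)
    then have "map_sum (Transposition.transpose a b \<circ> p) (id :: 'b \<Rightarrow> 'b)
        = Transposition.transpose (Inl a) (Inl b) \<circ> map_sum p id" ..
    moreover have "map_sum p (id :: 'b \<Rightarrow> 'b) permutes UNIV"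
      using swap.hyps by (intro map_sum_permutes permutes_id)
    ultimately show ?case
      using swap by (simp only: sign_transpose_comp sum.inject not_False_eq_True)
  qed (simp only: map_sum.id sign_id)
  have "sign (map_sum p r) = sign (map_sum p (id :: 'b \<Rightarrow> 'b)) * sign r"
    using assms(2) finite
  proof (induction rule: permutes_induct)
    case (swap a b r)
    have "map_sum p (Transposition.transpose a b \<circ> r) k
        = (Transposition.transpose (Inr a) (Inr b) \<circ> map_sum p r) k" for k
      by (cases k) (auto simp: Transposition.transpose_def)
    then have "map_sum p (Transposition.transpose a b \<circ> r)
        = Transposition.transpose (Inr a) (Inr b) \<circ> map_sum p r" ..
    moreover have "map_sum p r permutes UNIV"
      using swap.hyps assms(1) by (intro map_sum_permutes)
    ultimately show ?case
      using swap by (simp only: sign_transpose_comp sum.inject not_False_eq_True mult_minus_right)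
  qed simp
  then show ?thesis
    by (simp only: left)
qed

text \<open>A permutation contributes to the Leibniz expansion only if it maps the left summand into
  itself. By finiteness it then preserves the right summand as well and is a \<open>map_sum\<close>,
  so the expansion factors.\<close>

lemma det_block_triangular:
  fixes M :: "'a::comm_ring_1 ^ ('n::finite + 'm::finite) ^ ('n + 'm)"
  assumes zero: "\<And>a b. M $ Inl a $ Inr b = 0"
  shows "det M = det (\<chi> a b. M $ Inl a $ Inl b) * det (\<chi> a b. M $ Inr a $ Inr b)"
proof -
  let ?P = "{p :: 'n \<Rightarrow> 'n. p permutes UNIV}" and ?R = "{r :: 'm \<Rightarrow> 'm. r permutes UNIV}"
  let ?S = "{t :: 'n + 'm \<Rightarrow> 'n + 'm. t permutes UNIV}"
  let ?f = "\<lambda>(p, r). map_sum p r :: 'n + 'm \<Rightarrow> 'n + 'm"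
  let ?term = "\<lambda>t. of_int (sign t) * (\<Prod>k\<in>UNIV. M $ k $ t k)"
  have sub: "?f ` (?P \<times> ?R) \<subseteq> ?S"
    by (auto intro: map_sum_permutes)
  have inj: "inj_on ?f (?P \<times> ?R)"
  proof (rule inj_onI, clarify)
    fix p p' :: "'n \<Rightarrow> 'n" and r r' :: "'m \<Rightarrow> 'm"
    assume eq: "map_sum p r = map_sum p' r'"
    have "p a = p' a" "r b = r' b" for a b
      using fun_cong[OF eq, of "Inl a"] fun_cong[OF eq, of "Inr b"] by auto
    then show "p = p' \<and> r = r'"
      by auto
  qed
  have vanish: "?term t = 0" if t: "t \<in> ?S - ?f ` (?P \<times> ?R)" for t
  proof (rule ccontr)
    assume nz: "?term t \<noteq> 0"
    have bt: "bij t"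
      using t by (auto intro: permutes_bij)
    have inj_t: "inj t"
      using bt by (rule bij_is_inj)
    have l: "\<exists>a'. t (Inl a) = Inl a'" for a
    proof (rule ccontr)
      assume "\<nexists>a'. t (Inl a) = Inl a'"
      then obtain b where "t (Inl a) = Inr b"
        by (cases "t (Inl a)") auto
      then have "M $ Inl a $ t (Inl a) = 0"
        by (simp add: zero)
      then have "(\<Prod>k\<in>UNIV. M $ k $ t k) = 0"
        by (metis UNIV_I finite prod_zero)
      then show False
        using nz by simp
    qed
    then obtain p where p: "\<And>a. t (Inl a) = Inl (p a)"
      by metis
    have "inj p"
      using inj_t p by (metis injD injI sum.inject(1))
    then have bp: "bij p"
      by (simp add: bij_def finite_UNIV_inj_surj)
    \<comment> \<open>\<open>p\<close> is onto, so every value \<open>Inl a\<close> is already taken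
      by \<open>t\<close> on the left summand; by injectivity none is left for
      \<open>Inr b\<close>.\<close>
    have r: "\<exists>b'. t (Inr b) = Inr b'" for b
    proof (cases "t (Inr b)")
      case (Inl a)
      then obtain a' where "t (Inr b) = Inl (p a')"
        using bp by (metis bij_pointE)
      then have "t (Inr b) = t (Inl a')"
        by (simp add: p)
      then show ?thesis
        using inj_t by (metis injD sum.distinct(1))
    qed auto
    then obtain r where r: "\<And>b. t (Inr b) = Inr (r b)"
      by metis
    have "inj r"
      using inj_t r by (metis injD injI sum.inject(2))
    then have br: "bij r"
      by (simp add: bij_def finite_UNIV_inj_surj)
    have "t = map_sum p r"
    proof
      fix k show "t k = map_sum p r k"
        by (cases k) (simp_all add: p r)
    qed
    then have "t \<in> ?f ` (?P \<times> ?R)"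
      using bp br by (auto intro!: image_eqI[of _ _ "(p, r)"] bij_imp_permutes)
    then show False
      using t by blast
  qed
  have "det M = (\<Sum>t\<in>?S. ?term t)"
    by (simp add: det_def)
  also have "\<dots> = (\<Sum>t\<in>?f ` (?P \<times> ?R). ?term t)"
    by (rule sum.mono_neutral_right) (use sub vanish in auto)
  also have "\<dots> = (\<Sum>x\<in>?P \<times> ?R. ?term (?f x))"
    by (simp add: sum.reindex[OF inj] o_def)
  also have "\<dots> = (\<Sum>(p, r)\<in>?P \<times> ?R.
      (of_int (sign p) * (\<Prod>a\<in>UNIV. M $ Inl a $ Inl (p a))) *
      (of_int (sign r) * (\<Prod>b\<in>UNIV. M $ Inr b $ Inr (r b))))"
  proof (rule sum.cong[OF refl], clarify)
    fix p :: "'n \<Rightarrow> 'n" and r :: "'m \<Rightarrow> 'm"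
    assume pr: "p permutes UNIV" "r permutes UNIV"
    have "(\<Prod>k\<in>UNIV. M $ k $ map_sum p r k)
        = (\<Prod>a\<in>UNIV. M $ Inl a $ Inl (p a)) * (\<Prod>b\<in>UNIV. M $ Inr b $ Inr (r b))"
      by (subst UNIV_Plus_UNIV[symmetric]) (simp add: prod.Plus del: UNIV_Plus_UNIV)
    then show "?term (map_sum p r)
        = (of_int (sign p) * (\<Prod>a\<in>UNIV. M $ Inl a $ Inl (p a))) *
          (of_int (sign r) * (\<Prod>b\<in>UNIV. M $ Inr b $ Inr (r b)))"
      by (simp add: sign_map_sum[OF pr] algebra_simps)
  qed
  also have "\<dots> = det (\<chi> a b. M $ Inl a $ Inl b) * det (\<chi> a b. M $ Inr a $ Inr b)"
    by (simp add: det_def sum_product sum.cartesian_product)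
  finally show ?thesis .
qed

subsection \<open>Simplices around the origin\<close>

text \<open>Labels the vertices of the facet opposite \<open>k\<close> by \<open>'n\<close>. The
  place freed by removing \<open>Some c\<close> goes to \<open>None\<close>, which is the column
  order used in \<open>weight\<close>.\<close>

definition omit :: "'n option \<Rightarrow> 'n \<Rightarrow> 'n option" where
  "omit k c = (if Some c = k then None else Some c)"

lemma bij_betw_omit: "bij_betw (omit k) UNIV (UNIV - {k})"
proof -
  have "inj (omit k)"
    by (auto simp: inj_def omit_def split: if_splits)
  moreover have "j \<in> range (omit k)" if "j \<noteq> k" for j
  proof (cases j)
    case None
    with that obtain c where "k = Some c"
      by (cases k) auto
    then have "omit k c = j"
      by (simp add: None omit_def)
    then show ?thesis
      by blast
  next
    case (Some c)
    then have "omit k c = j"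
      using that by (auto simp: omit_def)
    then show ?thesis
      by blast
  qed
  ultimately show ?thesis
    by (auto simp: bij_betw_def omit_def split: if_splits)
qed

lemma omit_neq [simp]: "omit k c \<noteq> k"
  by (auto simp: omit_def)

lemma omit_cases:
  assumes "l \<noteq> k"
  obtains c where "l = omit k c"
  using assms bij_betw_omit[of k] by (metis DiffI UNIV_I bij_betw_imp_surj_on imageE singletonD)

lemma sum_omit:
  fixes f :: "'n::finite option \<Rightarrow> 'a::comm_monoid_add"
  shows "(\<Sum>k\<in>UNIV. f k) = f j + (\<Sum>c\<in>UNIV. f (omit j c))"
proof -
  have "(\<Sum>k\<in>UNIV. f k) = f j + (\<Sum>k\<in>UNIV - {j}. f k)"
    by (rule sum.remove) auto
  then show ?thesis
    using sum.reindex_bij_betw[OF bij_betw_omit, of f j] by simp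
qed

definition facet_matrix :: "('n option \<Rightarrow> real ^ 'n) \<Rightarrow> 'n option \<Rightarrow> real ^ 'n ^ 'n" where
  "facet_matrix u k = (\<chi> r c. u (omit k c) $ r)"

lemma column_facet_matrix: "column c (facet_matrix u k) = u (omit k c)"
  by (simp add: column_def facet_matrix_def vec_eq_iff)

lemma transpose_facet_matrix_mult:
  "transpose (facet_matrix u k) *v y = (\<chi> c. y \<bullet> u (omit k c))"
  unfolding transpose_def facet_matrix_def matrix_vector_mult_def inner_vec_def
  by (simp add: vec_eq_iff mult.commute)

lemma weight_facet_matrix: "weight u k = nat \<lfloor>\<bar>det (facet_matrix u k)\<bar>\<rfloor>"
  by (simp add: weight_def facet_matrix_def omit_def if_distrib[of u])

text \<open>Solving the relation for \<open>u None\<close> expresses it in the columns of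
  \<open>facet_matrix u None\<close>. Passing to \<open>k = Some a\<close> puts
  \<open>u None\<close> into column \<open>a\<close>, so Cramer's rule gives the factor between the
  determinants.\<close>

lemma facet_matrix_cramer:
  fixes u :: "'n::finite option \<Rightarrow> real ^ 'n"
  assumes rel: "(\<Sum>k\<in>UNIV. c k *\<^sub>R u k) = 0" and nz: "c None \<noteq> 0"
  shows "\<bar>det (facet_matrix u k)\<bar> = \<bar>c k / c None\<bar> * \<bar>det (facet_matrix u None)\<bar>"
proof (cases k)
  case None
  then show ?thesis
    using nz by simp
next
  case (Some a)
  define x :: "real ^ 'n" where "x = (\<chi> b. - c (Some b) / c None)"
  have "c None *\<^sub>R (facet_matrix u None *v x) = - (\<Sum>b\<in>UNIV. c (Some b) *\<^sub>R u (Some b))"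
    using nz by (simp add: matrix_mult_sum column_facet_matrix x_def scalar_mult_eq_scaleR omit_def
        scaleR_sum_right sum_negf)
  also have "\<dots> = c None *\<^sub>R u None"
    using rel sum_omit[of "\<lambda>k. c k *\<^sub>R u k" None]
    by (simp add: omit_def eq_neg_iff_add_eq_0 eq_commute[of _ "c None *\<^sub>R u None"])
  finally have "facet_matrix u None *v x = u None"
    using nz by simp
  then have "facet_matrix u k = (\<chi> i j. if j = a then (facet_matrix u None *v x) $ i
      else facet_matrix u None $ i $ j)"
    by (simp add: facet_matrix_def omit_def Some vec_eq_iff)
  then have "det (facet_matrix u k) = x $ a * det (facet_matrix u None)"
    by (simp add: cramer_lemma)
  then show ?thesis
    by (simp add: x_def Some abs_mult)
qed

text \<open>Without its \<open>k\<close>-th term the relation is one among the columns of an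
  invertible matrix.\<close>

lemma facet_relation_trivial:
  fixes u :: "'n::finite option \<Rightarrow> real ^ 'n"
  assumes "det (facet_matrix u k) \<noteq> 0" "(\<Sum>l\<in>UNIV. b l *\<^sub>R u l) = 0" "b k = 0"
  shows "b l = 0"
proof (cases "l = k")
  case False
  then obtain a where a: "l = omit k a"
    by (rule omit_cases)
  have "(\<Sum>c\<in>UNIV. b (omit k c) *s column c (facet_matrix u k)) = 0"
    using assms(2,3) sum_omit[of "\<lambda>l. b l *\<^sub>R u l" k]
    by (simp add: column_facet_matrix scalar_mult_eq_scaleR)
  moreover have "\<exists>B. B ** facet_matrix u k = mat 1"
    using assms(1) invertible_det_nz invertible_left_inverse by blast
  ultimately show ?thesis
    unfolding matrix_left_invertible_independent_columns a by (metis (no_types))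
qed (simp add: assms)

text \<open>The transposed facet matrix sends \<open>y\<close> to its inner products with the
  vertices of the facet. Its surjectivity yields the normal, its injectivity the uniqueness
  below.\<close>

lemma facet_normal_exists:
  fixes u :: "'n::finite option \<Rightarrow> real ^ 'n"
  assumes "det (facet_matrix u k) \<noteq> 0"
  shows "\<exists>y. \<forall>l. l \<noteq> k \<longrightarrow> y \<bullet> u l = 1"
proof -
  have "\<exists>B. transpose (facet_matrix u k) ** B = mat 1"
    using assms by (metis det_transpose invertible_det_nz invertible_def)
  then obtain y where "transpose (facet_matrix u k) *v y = (\<chi> c. 1)"
    unfolding matrix_right_invertible_surjective by (metis surjD)
  then have "y \<bullet> u (omit k c) = 1" for c
    by (simp only: transpose_facet_matrix_mult vec_eq_iff vec_lambda_beta)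
  then show ?thesis
    by (metis omit_cases)
qed

lemma facet_normal_unique:
  fixes u :: "'n::finite option \<Rightarrow> real ^ 'n"
  assumes "det (facet_matrix u k) \<noteq> 0" "\<And>l. l \<noteq> k \<Longrightarrow> y \<bullet> u l = z \<bullet> u l"
  shows "y = z"
proof -
  have "\<exists>B. B ** transpose (facet_matrix u k) = mat 1"
    using assms(1) by (metis det_transpose invertible_det_nz invertible_def)
  moreover have "transpose (facet_matrix u k) *v (y - z) = 0"
    using assms(2) unfolding transpose_facet_matrix_mult
    by (simp add: vec_eq_iff inner_diff_left)
  ultimately have "y - z = 0"
    unfolding matrix_left_invertible_ker by blast
  then show ?thesis
    by simp
qed

text \<open>
  By \<open>positive_circuit_iff\<close> below, such coefficients exist iff \<open>u\<close> enumerates the vertices of a simplex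
  with the origin in its interior.
\<close>

definition positive_circuit :: "('n::finite option \<Rightarrow> real ^ 'n) \<Rightarrow> ('n option \<Rightarrow> real) \<Rightarrow> bool" where
  "positive_circuit u c \<longleftrightarrow>
     (\<forall>k. 0 < c k) \<and> (\<Sum>k\<in>UNIV. c k *\<^sub>R u k) = 0 \<and> det (facet_matrix u None) \<noteq> 0"

lemma positive_circuit_scale:
  assumes "positive_circuit u c" "0 < t"
  shows "positive_circuit u (\<lambda>k. t * c k)"
  using assms by (simp add: positive_circuit_def scaleR_sum_right[symmetric] flip: scaleR_scaleR)

text \<open>The normalized coefficients are the barycentric coordinates of the origin.\<close>

lemma positive_circuit_normalize:
  assumes "positive_circuit u c"
  obtains e where "positive_circuit u e" "sum e UNIV = 1"
proof
  have pos: "0 < sum c UNIV"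
    using assms by (intro sum_pos) (auto simp: positive_circuit_def)
  then show "positive_circuit u (\<lambda>k. inverse (sum c UNIV) * c k)"
    using assms by (intro positive_circuit_scale) auto
  show "(\<Sum>k\<in>UNIV. inverse (sum c UNIV) * c k) = 1"
    using pos by (simp flip: sum_distrib_left)
qed

text \<open>\<open>positive_circuit\<close> speaks only of the facet opposite \<open>None\<close>;
  Cramer's rule carries this to every other facet because all coefficients are positive.\<close>

lemma det_facet_matrix_nonzero:
  assumes "positive_circuit u c"
  shows "det (facet_matrix u k) \<noteq> 0"
proof -
  have c: "0 < c k" "0 < c None" for k
    using assms by (auto simp: positive_circuit_def)
  have "\<bar>det (facet_matrix u k)\<bar> = \<bar>c k / c None\<bar> * \<bar>det (facet_matrix u None)\<bar>"
  proof (rule facet_matrix_cramer)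
    show "(\<Sum>k\<in>UNIV. c k *\<^sub>R u k) = 0"
      using assms by (simp add: positive_circuit_def)
    show "c None \<noteq> 0"
      using c(2) by simp
  qed
  then show ?thesis
    using assms less_imp_neq[OF c(1)[of k]] less_imp_neq[OF c(2)]
    by (auto simp: positive_circuit_def)
qed

lemma affine_dependent_range_iff:
  fixes u :: "'k::finite \<Rightarrow> 'a::real_vector"
  assumes "inj u"
  shows "affine_dependent (range u) \<longleftrightarrow>
    (\<exists>b. sum b UNIV = 0 \<and> (\<Sum>k\<in>UNIV. b k *\<^sub>R u k) = 0 \<and> (\<exists>k. b k \<noteq> 0))"
proof -
  have "affine_dependent (range u) \<longleftrightarrow>
      (\<exists>U. (\<Sum>k\<in>UNIV. U (u k)) = 0 \<and> (\<exists>k. U (u k) \<noteq> 0) \<and> (\<Sum>k\<in>UNIV. U (u k) *\<^sub>R u k) = 0)"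
    by (simp add: affine_dependent_explicit_finite sum.reindex[OF assms] o_def)
  also have "\<dots> \<longleftrightarrow> (\<exists>b. sum b UNIV = 0 \<and> (\<Sum>k\<in>UNIV. b k *\<^sub>R u k) = 0 \<and> (\<exists>k. b k \<noteq> 0))"
    (is "?L \<longleftrightarrow> ?R")
  proof
    assume ?R
    then obtain b where b: "sum b UNIV = 0" "(\<Sum>k\<in>UNIV. b k *\<^sub>R u k) = 0" "\<exists>k. b k \<noteq> 0"
      by blast
    then show ?L
      using assms by (intro exI[of _ "b \<circ> inv u"]) simp
  qed blast
  finally show ?thesis .
qed

text \<open>An interior point of a full-dimensional simplex has positive barycentric coordinates,
  and those of the origin are the coefficients \<open>c\<close> up to scale. A nonzero determinant
  makes every linear relation among the vertices a multiple of \<open>c\<close>; as \<open>c\<close>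
  has positive sum, only the trivial multiple has coefficient sum 0.\<close>

lemma positive_circuit_iff:
  fixes u :: "'n::finite option \<Rightarrow> real ^ 'n"
  shows "(\<exists>c. positive_circuit u c) \<longleftrightarrow>
    inj u \<and> \<not> affine_dependent (range u) \<and> 0 \<in> interior (convex hull (range u))"
    (is "?L \<longleftrightarrow> ?R")
proof
  assume ?R
  then have inj: "inj u" and ind: "\<not> affine_dependent (range u)"
    and int: "0 \<in> interior (convex hull (range u))"
    by auto
  obtain U where U: "\<forall>x\<in>range u. 0 < U x" "sum U (range u) = 1" "(\<Sum>x\<in>range u. U x *\<^sub>R x) = 0"
    using int unfolding interior_convex_hull_explicit_minimal[OF ind] by (auto split: if_splits)
  define c where "c = U \<circ> u"
  have c: "\<And>k. 0 < c k" "sum c UNIV = 1" "(\<Sum>k\<in>UNIV. c k *\<^sub>R u k) = 0"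
    using U by (auto simp: c_def sum.reindex[OF inj] o_def)
  have "b a = 0" if b: "(\<Sum>a\<in>UNIV. b a *s column a (facet_matrix u None)) = 0" for b a
  proof -
    \<comment> \<open>The relation is extended by 0 at \<open>None\<close>. Subtracting
      \<open>t * c\<close> makes its coefficients sum to 0, so affine independence gives
      \<open>b' = t * c\<close>, and the entry at \<open>None\<close> forces
      \<open>t = 0\<close>.\<close>
    define b' where "b' k = (case k of None \<Rightarrow> 0 | Some a \<Rightarrow> b a)" for k
    define t where "t = sum b' UNIV"
    have rel: "(\<Sum>k\<in>UNIV. b' k *\<^sub>R u k) = 0"
      using b by (simp add: sum_omit[of _ None] b'_def omit_def column_facet_matrix
          scalar_mult_eq_scaleR)
    have "(\<Sum>k\<in>UNIV. b' k - t * c k) = 0"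
      by (simp add: sum_subtractf c t_def flip: sum_distrib_left)
    moreover have "(\<Sum>k\<in>UNIV. (b' k - t * c k) *\<^sub>R u k) = 0"
      by (simp add: scaleR_diff_left sum_subtractf rel c scaleR_sum_right[symmetric]
          flip: scaleR_scaleR)
    ultimately have "b' k - t * c k = 0" for k
      using ind unfolding affine_dependent_range_iff[OF inj] by metis
    then have eq: "b' k = t * c k" for k
      by simp
    have "t = 0"
      using eq[of None] c(1)[of None] by (simp add: b'_def)
    then show ?thesis
      using eq[of "Some a"] by (simp add: b'_def)
  qed
  then have "\<exists>B. B ** facet_matrix u None = mat 1"
    unfolding matrix_left_invertible_independent_columns by blast
  then have "det (facet_matrix u None) \<noteq> 0"
    using invertible_det_nz invertible_left_inverse by blast
  then show ?L
    using c by (auto simp: positive_circuit_def)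
next
  assume ?L
  then obtain c where circ: "positive_circuit u c" and sum1: "sum c UNIV = 1"
    using positive_circuit_normalize by metis
  have c: "\<And>k. 0 < c k" "(\<Sum>k\<in>UNIV. c k *\<^sub>R u k) = 0"
    using circ by (auto simp: positive_circuit_def)
  have indep: "b k = 0" if b: "sum b UNIV = 0" "(\<Sum>k\<in>UNIV. b k *\<^sub>R u k) = 0" for b k
  proof -
    \<comment> \<open>This multiple of \<open>c\<close> cancels the coefficient at
      \<open>None\<close>; comparing sums afterwards gives \<open>r = 0\<close>.\<close>
    define r where "r = b None / c None"
    have eq: "b k - r * c k = 0" for k
    proof (rule facet_relation_trivial)
      show "det (facet_matrix u None) \<noteq> 0"
        using circ by (simp add: positive_circuit_def)
      show "(\<Sum>k\<in>UNIV. (b k - r * c k) *\<^sub>R u k) = 0"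
        by (simp add: scaleR_diff_left sum_subtractf b c scaleR_sum_right[symmetric]
            flip: scaleR_scaleR)
      show "b None - r * c None = 0"
        using c(1)[of None] by (simp add: r_def)
    qed
    then have "sum b UNIV = r * sum c UNIV"
      by (simp add: sum_distrib_left)
    then show ?thesis
      using eq[of k] b sum1 by simp
  qed
  have inj: "inj u"
  proof (rule injI, rule ccontr)
    fix k l assume kl: "u k = u l" "k \<noteq> l"
    define b where "b j = of_bool (j = k) - (of_bool (j = l) :: real)" for j
    have "sum b UNIV = 0"
      by (simp add: b_def sum_subtractf)
    moreover have "(\<Sum>j\<in>UNIV. b j *\<^sub>R u j) = 0"
      using kl by (simp add: b_def scaleR_diff_left sum_subtractf of_bool_def if_distrib[of "\<lambda>x. x *\<^sub>R _"]
          cong: if_cong)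
    ultimately have "b k = 0"
      by (rule indep)
    then show False
      using kl by (simp add: b_def)
  qed
  moreover have ind: "\<not> affine_dependent (range u)"
    unfolding affine_dependent_range_iff[OF inj] using indep by blast
  moreover have "0 \<in> interior (convex hull (range u))"
  proof -
    \<comment> \<open>With at most \<open>CARD('n)\<close> vertices the interior would be empty; one
      more makes its description by positive coefficients available.\<close>
    have "card (range u) = CARD('n) + 1"
      using inj by (simp add: card_image)
    moreover have "\<exists>U. (\<forall>x\<in>range u. 0 < U x) \<and> sum U (range u) = 1 \<and> (\<Sum>x\<in>range u. U x *\<^sub>R x) = 0"
      using inj c sum1
      by (intro exI[of _ "c \<circ> inv u"]) (simp add: sum.reindex[OF inj] o_def)
    ultimately show ?thesis
      by (simp add: interior_convex_hull_explicit_minimal[OF ind])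
  qed
  ultimately show ?R
    by blast
qed

subsection \<open>Polar duals and lattice facet normals\<close>

text \<open>Pair \<open>y\<close> with the barycentric relation of the origin: the vertices of the
  facet contribute \<open>1 - c k\<close> in total. In particular
  \<open>y \<bullet> u k < 1\<close>.\<close>

lemma facet_normal_opposite:
  assumes circ: "positive_circuit u c" and sum1: "sum c UNIV = 1"
    and y: "\<And>l. l \<noteq> k \<Longrightarrow> y \<bullet> u l = 1"
  shows "c k * (1 - y \<bullet> u k) = 1"
proof -
  have "0 = y \<bullet> (\<Sum>l\<in>UNIV. c l *\<^sub>R u l)"
    using circ by (simp add: positive_circuit_def)
  also have "\<dots> = (\<Sum>l\<in>UNIV. c l * (y \<bullet> u l))"
    by (simp add: inner_sum_right)
  also have "\<dots> = c k * (y \<bullet> u k) + (\<Sum>a\<in>UNIV. c (omit k a))"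
    by (simp add: sum_omit[of _ k] y)
  also have "(\<Sum>a\<in>UNIV. c (omit k a)) = 1 - c k"
    using sum1 by (simp add: sum_omit[of c k])
  finally show ?thesis
    by (simp add: algebra_simps)
qed

lemma polar_dual_convex_hull:
  "polar_dual (convex hull V) = {y. \<forall>x\<in>V. x \<bullet> y \<le> 1}"
proof -
  have "x \<bullet> y \<le> 1" if "\<forall>x\<in>V. x \<bullet> y \<le> 1" "x \<in> convex hull V" for x y
  proof -
    have "convex hull V \<subseteq> {x. y \<bullet> x \<le> 1}"
      using that(1) by (intro hull_minimal convex_halfspace_le) (auto simp: inner_commute)
    then show ?thesis
      using that(2) by (auto simp: inner_commute)
  qed
  then show ?thesis
    by (auto simp: polar_dual_def hull_inc)
qed

text \<open>The normals lie in the dual because each takes the value 1 on its facet and a smaller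
  one at the opposite vertex. Conversely, a point of the dual is determined by its values at the
  vertices, and a convex combination of the normals reproduces these.\<close>

lemma polar_dual_simplex:
  fixes u :: "'n::finite option \<Rightarrow> real ^ 'n"
  assumes circ: "positive_circuit u c"
    and y: "\<And>k l. l \<noteq> k \<Longrightarrow> y k \<bullet> u l = 1"
  shows "polar_dual (convex hull (range u)) = convex hull (range y)"
proof -
  obtain e where e: "positive_circuit u e" "sum e UNIV = 1"
    using circ by (rule positive_circuit_normalize)
  have pos: "0 < e k" for k
    using e(1) by (simp add: positive_circuit_def)
  have opp: "e k * (1 - y k \<bullet> u k) = 1" for k
    using e y by (rule facet_normal_opposite)
  have "y k \<bullet> u l \<le> 1" for k l
  proof (cases "l = k")
    case True
    have "0 < 1 - y k \<bullet> u k"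
      using opp[of k] pos[of k] by (metis zero_less_mult_pos zero_less_one)
    then show ?thesis
      using True by simp
  qed (simp add: y)
  then have "convex hull (range y) \<subseteq> polar_dual (convex hull (range u))"
  proof (intro hull_minimal)
    have "polar_dual (convex hull (range u)) = (\<Inter>k. {z. u k \<bullet> z \<le> 1})"
      by (auto simp: polar_dual_convex_hull)
    then show "convex (polar_dual (convex hull (range u)))"
      by (simp add: convex_INT convex_halfspace_le)
  qed (auto simp: polar_dual_convex_hull inner_commute)
  moreover have "z \<in> convex hull (range y)" if z: "z \<in> polar_dual (convex hull (range u))" for z
  proof -
    have z_le: "z \<bullet> u k \<le> 1" for k
      using z by (simp add: polar_dual_convex_hull inner_commute)
    \<comment> \<open>If \<open>z\<close> is a combination of the \<open>y k\<close> with
      coefficients of sum 1, pairing it with \<open>u k\<close> and using \<open>opp\<close> forces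
      these coefficients.\<close>
    define t where "t k = e k * (1 - z \<bullet> u k)" for k
    have "z \<bullet> (\<Sum>k\<in>UNIV. e k *\<^sub>R u k) = 0"
      using e(1) by (simp add: positive_circuit_def)
    then have t_sum: "sum t UNIV = 1"
      using e(2) by (simp add: t_def algebra_simps sum_subtractf inner_sum_right)
    have t_nonneg: "0 \<le> t k" for k
      using z_le[of k] pos[of k] by (simp add: t_def)
    have "z \<bullet> u l = (\<Sum>k\<in>UNIV. t k *\<^sub>R y k) \<bullet> u l" for l
    proof -
      have "(\<Sum>k\<in>UNIV. t k *\<^sub>R y k) \<bullet> u l = (\<Sum>k\<in>UNIV. t k * (y k \<bullet> u l))"
        by (simp add: inner_sum_left)
      also have "\<dots> = t l * (y l \<bullet> u l) + (\<Sum>a\<in>UNIV. t (omit l a))"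
        by (simp add: sum_omit[of _ l] y omit_neq[symmetric] del: omit_neq)
      also have "(\<Sum>a\<in>UNIV. t (omit l a)) = 1 - t l"
        using t_sum by (simp add: sum_omit[of t l])
      also have "t l * (y l \<bullet> u l) + (1 - t l) = 1 - (e l * (1 - y l \<bullet> u l)) * (1 - z \<bullet> u l)"
        by (simp add: t_def algebra_simps)
      also have "\<dots> = z \<bullet> u l"
        by (simp add: opp)
      finally show ?thesis ..
    qed
    then have "z = (\<Sum>k\<in>UNIV. t k *\<^sub>R y k)"
      using det_facet_matrix_nonzero[OF circ] by (intro facet_normal_unique) auto
    also have "\<dots> \<in> convex hull (range y)"
      using t_sum t_nonneg by (intro convex_sum) (auto simp: hull_inc)
    finally show ?thesis .
  qed
  ultimately show ?thesis
    by blast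
qed

text \<open>On the dual each \<open>u l\<close> has values at most 1, and for
  \<open>l \<noteq> k\<close> it attains 1 at \<open>y k\<close>. The endpoints of an open segment
  through \<open>y k\<close> inside the dual then attain it too and coincide, since a normal is
  unique. This makes the normals lattice points when the dual is a lattice polytope.\<close>

lemma facet_normal_extreme_point:
  fixes u :: "'n::finite option \<Rightarrow> real ^ 'n"
  assumes circ: "positive_circuit u c"
    and y: "\<And>k l. l \<noteq> k \<Longrightarrow> y k \<bullet> u l = 1"
  shows "y k extreme_point_of polar_dual (convex hull (range u))"
  unfolding extreme_point_of_def
proof (intro conjI ballI notI)
  have "polar_dual (convex hull (range u)) = convex hull (range y)"
    using circ y by (rule polar_dual_simplex)
  then show "y k \<in> polar_dual (convex hull (range u))"
    by (simp add: hull_inc)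
next
  fix a b
  assume ab: "a \<in> polar_dual (convex hull (range u))" "b \<in> polar_dual (convex hull (range u))"
  assume "y k \<in> open_segment a b"
  then obtain t where "a \<noteq> b" and t: "0 < t" "t < 1" "y k = (1 - t) *\<^sub>R a + t *\<^sub>R b"
    unfolding in_segment by blast
  have "a \<bullet> u l = b \<bullet> u l" if "l \<noteq> k" for l
  proof -
    have le: "a \<bullet> u l \<le> 1" "b \<bullet> u l \<le> 1"
      using ab by (auto simp: polar_dual_convex_hull inner_commute)
    have eq: "(1 - t) * (1 - a \<bullet> u l) + t * (1 - b \<bullet> u l) = 0"
      using y[OF that] t(3) by (simp add: inner_add_left algebra_simps)
    have "0 \<le> (1 - t) * (1 - a \<bullet> u l)" "0 \<le> t * (1 - b \<bullet> u l)"
      using le t by auto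
    then have "(1 - t) * (1 - a \<bullet> u l) = 0" "t * (1 - b \<bullet> u l) = 0"
      using eq by linarith+
    then show ?thesis
      using t by simp
  qed
  then have "a = b"
    using det_facet_matrix_nonzero[OF circ] by (intro facet_normal_unique)
  then show False
    using \<open>a \<noteq> b\<close> by simp
qed

lemma lattice_point_extreme:
  assumes "lattice_polytope P" "x extreme_point_of P"
  shows "lattice_point x"
  using assms extreme_point_of_convex_hull by (auto simp: lattice_polytope_def)

text \<open>The vertices are extreme points of the simplex and the facet normals are extreme points
  of the dual, while extreme points of a lattice polytope are lattice points. Conversely, the
  simplex and its dual are the hulls of these points.\<close>

lemma origin_reflexive_simplex_iff:
  fixes u :: "'n::finite option \<Rightarrow> real ^ 'n"
  shows "origin_reflexive_simplex u \<longleftrightarrow>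
    (\<exists>c. positive_circuit u c) \<and> (\<forall>k. lattice_point (u k)) \<and>
    (\<forall>k. \<exists>y. lattice_point y \<and> (\<forall>l. l \<noteq> k \<longrightarrow> y \<bullet> u l = 1))"
    (is "_ \<longleftrightarrow> ?circ \<and> ?vert \<and> ?norm")
proof
  assume *: "origin_reflexive_simplex u"
  then have ind: "\<not> affine_dependent (range u)"
    and lat: "lattice_polytope (convex hull (range u))"
    and dual: "lattice_polytope (polar_dual (convex hull (range u)))"
    by (auto simp: origin_reflexive_simplex_def origin_reflexive_def)
  have circ: ?circ
    using * by (simp add: origin_reflexive_simplex_def origin_reflexive_def positive_circuit_iff)
  have "lattice_point (u k)" for k
    using lat by (rule lattice_point_extreme)
      (simp add: extreme_point_of_convex_hull_affine_independent[OF ind])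
  moreover have ?norm
  proof -
    from circ obtain c where c: "positive_circuit u c" ..
    have "\<exists>y. \<forall>l. l \<noteq> k \<longrightarrow> y \<bullet> u l = 1" for k
      using det_facet_matrix_nonzero[OF c] by (rule facet_normal_exists)
    then obtain y where y: "\<And>k l. l \<noteq> k \<Longrightarrow> y k \<bullet> u l = 1"
      by metis
    have "lattice_point (y k)" for k
      using dual facet_normal_extreme_point[OF c y] by (rule lattice_point_extreme)
    then show ?norm
      using y by blast
  qed
  ultimately show "?circ \<and> ?vert \<and> ?norm"
    using circ by blast
next
  assume *: "?circ \<and> ?vert \<and> ?norm"
  then obtain c y where c: "positive_circuit u c" and lat: "\<And>k. lattice_point (u k)"
    and y: "\<And>k. lattice_point (y k)" "\<And>k l. l \<noteq> k \<Longrightarrow> y k \<bullet> u l = 1"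
    by metis
  have "lattice_polytope (convex hull (range u))"
    using lat unfolding lattice_polytope_def by (intro exI[of _ "range u"]) auto
  moreover have "lattice_polytope (convex hull (range y))"
    using y(1) unfolding lattice_polytope_def by (intro exI[of _ "range y"]) auto
  moreover have "polar_dual (convex hull (range u)) = convex hull (range y)"
    using c y(2) by (rule polar_dual_simplex)
  ultimately show "origin_reflexive_simplex u"
    using *
    by (simp add: origin_reflexive_simplex_def origin_reflexive_def positive_circuit_iff)
qed

subsection \<open>Weights\<close>

lemma det_in_Ints:
  assumes "\<And>i j. M $ i $ j \<in> \<int>"
  shows "det M \<in> \<int>"
  unfolding det_def by (intro Ints_sum Ints_mult Ints_prod assms Ints_of_int)

text \<open>An integer matrix has an integer determinant, so the floor in \<open>weight\<close>
  loses nothing.\<close>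

lemma real_weight:
  assumes "\<And>k. lattice_point (u k)"
  shows "real (weight u k) = \<bar>det (facet_matrix u k)\<bar>"
proof -
  have "\<bar>det (facet_matrix u k)\<bar> \<in> \<int>"
    using assms by (intro Ints_abs det_in_Ints) (simp add: facet_matrix_def lattice_point_def)
  then show ?thesis
    by (simp add: weight_facet_matrix of_int_floor)
qed

text \<open>By Cramer's rule the weights are proportional to the coefficients of the circuit, so one
  weight fixes the common factor.\<close>

lemma weight_eqI:
  fixes u :: "'n::finite option \<Rightarrow> real ^ 'n"
  assumes circ: "positive_circuit u (\<lambda>k. real (c k))" and lat: "\<And>k. lattice_point (u k)"
    and None: "weight u None = t * c None"
  shows "weight u k = t * c k"
proof -
  have pos: "0 < c None"
    using circ by (simp add: positive_circuit_def)
  have "real (weight u k) = \<bar>real (c k) / real (c None)\<bar> * real (weight u None)"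
    using circ pos unfolding real_weight[OF lat] positive_circuit_def
    by (intro facet_matrix_cramer) auto
  also have "\<dots> = real (t * c k)"
    using pos by (simp add: None)
  finally show ?thesis
    by (simp only: of_nat_eq_iff)
qed

text \<open>The weights are a positive multiple of any positive circuit, hence themselves the
  coefficients of one.\<close>

lemma weight_circuit:
  fixes u :: "'n::finite option \<Rightarrow> real ^ 'n"
  assumes "origin_reflexive_simplex u"
  shows "positive_circuit u (\<lambda>k. real (weight u k))"
proof -
  obtain c where c: "positive_circuit u c" and lat: "\<And>k. lattice_point (u k)"
    using assms by (auto simp: origin_reflexive_simplex_iff)
  define t where "t = \<bar>det (facet_matrix u None)\<bar> / c None"
  have pos: "0 < c k" for k
    using c by (simp add: positive_circuit_def)
  have "real (weight u k) = t * c k" for k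
  proof -
    have "real (weight u k) = \<bar>c k / c None\<bar> * \<bar>det (facet_matrix u None)\<bar>"
      unfolding real_weight[OF lat]
    proof (rule facet_matrix_cramer)
      show "(\<Sum>k\<in>UNIV. c k *\<^sub>R u k) = 0"
        using c by (simp add: positive_circuit_def)
      show "c None \<noteq> 0"
        using pos[of None] by simp
    qed
    then show ?thesis
      using pos[of k] pos[of None] by (simp add: t_def)
  qed
  moreover have "0 < t"
    using c pos[of None] by (simp add: t_def positive_circuit_def)
  ultimately show ?thesis
    using positive_circuit_scale[OF c] by simp
qed

lemma weight_gcd_mult_reduced_weight: "weight_gcd u * reduced_weight u k = weight u k"
  by (simp add: weight_gcd_def reduced_weight_def Gcd_dvd)

lemma weight_gcd_pos:
  assumes "origin_reflexive_simplex u"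
  shows "0 < weight_gcd u"
proof -
  have "0 < weight u None"
    using weight_circuit[OF assms] by (simp add: positive_circuit_def)
  then show ?thesis
    using weight_gcd_mult_reduced_weight[of u None] by (metis gr0I mult_0 less_irrefl)
qed

lemma reduced_weight_circuit:
  fixes u :: "'n::finite option \<Rightarrow> real ^ 'n"
  assumes "origin_reflexive_simplex u"
  shows "positive_circuit u (\<lambda>k. real (reduced_weight u k))"
proof -
  have "real (reduced_weight u k) = inverse (real (weight_gcd u)) * real (weight u k)" for k
    using weight_gcd_pos[OF assms]
    by (simp flip: weight_gcd_mult_reduced_weight[of u k])
  then show ?thesis
    using positive_circuit_scale[OF weight_circuit[OF assms], of "inverse (real (weight_gcd u))"]
      weight_gcd_pos[OF assms] by simp
qed

lemma Gcd_range_mult: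
  fixes f :: "'a \<Rightarrow> nat"
  shows "Gcd (range (\<lambda>k. c * f k)) = c * Gcd (range f)"
  using Gcd_mult[of c "range f"] by (simp add: image_image)

text \<open>Multiplying by \<open>weight_gcd u\<close> gives back the gcd of the weights, and this
  positive factor cancels.\<close>

lemma Gcd_reduced_weight:
  assumes "origin_reflexive_simplex u"
  shows "Gcd (range (reduced_weight u)) = 1"
proof -
  have "weight_gcd u * Gcd (range (reduced_weight u)) = weight_gcd u"
    unfolding Gcd_range_mult[symmetric] weight_gcd_mult_reduced_weight
    by (simp add: weight_gcd_def)
  then show ?thesis
    using weight_gcd_pos[OF assms] by simp
qed

subsection \<open>The join\<close>

lemma pair_vec_nth [simp]:
  "pair_vec x y $ Inl a = x $ a" "pair_vec x y $ Inr b = y $ b"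
  by (simp_all add: pair_vec_def)

lemma pair_vec_eqI:
  assumes "\<And>a. z $ Inl a = x $ a" "\<And>b. z $ Inr b = y $ b"
  shows "z = pair_vec x y"
  unfolding vec_eq_iff
proof
  fix k show "z $ k = pair_vec x y $ k"
    by (cases k) (simp_all add: assms)
qed

lemma pair_vec_zero: "pair_vec 0 0 = 0"
  by (rule pair_vec_eqI[symmetric]) simp_all

lemma pair_vec_add: "pair_vec x y + pair_vec x' y' = pair_vec (x + x') (y + y')"
  by (rule pair_vec_eqI) simp_all

lemma pair_vec_scaleR: "r *\<^sub>R pair_vec x y = pair_vec (r *\<^sub>R x) (r *\<^sub>R y)"
  by (rule pair_vec_eqI) simp_all

lemma pair_vec_sum: "(\<Sum>k\<in>A. pair_vec (f k) (g k)) = pair_vec (sum f A) (sum g A)"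
  by (rule pair_vec_eqI) simp_all

lemma sum_UNIV_Plus:
  fixes f :: "'a::finite + 'b::finite \<Rightarrow> 'c::comm_monoid_add"
  shows "(\<Sum>k\<in>UNIV. f k) = (\<Sum>a\<in>UNIV. f (Inl a)) + (\<Sum>b\<in>UNIV. f (Inr b))"
  by (subst UNIV_Plus_UNIV[symmetric]) (simp add: sum.Plus del: UNIV_Plus_UNIV)

lemma inner_pair_vec:
  fixes x x' :: "real ^ 'n::finite" and y y' :: "real ^ 'm::finite"
  shows "pair_vec x y \<bullet> pair_vec x' y' = x \<bullet> x' + y \<bullet> y'"
  by (simp add: inner_vec_def sum_UNIV_Plus)

lemma lattice_point_pair_vec:
  "lattice_point (pair_vec x y) \<longleftrightarrow> lattice_point x \<and> lattice_point y"
  unfolding lattice_point_def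
proof (safe, goal_cases)
  case (3 k)
  then show ?case
    by (cases k) auto
next
  case (1 a)
  then show ?case
    by (metis pair_vec_nth(1))
next
  case (2 b)
  then show ?case
    by (metis pair_vec_nth(2))
qed

lemma lattice_point_zero: "lattice_point 0"
  by (simp add: lattice_point_def)

lemma lattice_point_scaleR:
  assumes "r \<in> \<int>" "lattice_point x"
  shows "lattice_point (r *\<^sub>R x)"
  using assms by (simp add: lattice_point_def)

lemma inner_lattice_points:
  assumes "lattice_point x" "lattice_point y"
  shows "x \<bullet> y \<in> \<int>"
  unfolding inner_vec_def using assms by (auto simp: lattice_point_def)

text \<open>
  The label \<open>Inl j\<close> stands for the vertex \<open>(v\<^sub>j, w\<^sub>i)\<close>, and \<open>Inr b\<close> for \<open>(0, w\<^sub>k)\<close> with \<open>k = omit i b\<close>.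
  Removing \<open>None\<close> leaves a block triangular matrix whose diagonal blocks are exactly the ones
  in \<open>weight v None\<close> and \<open>weight w i\<close>.
\<close>

definition join_label :: "('n + 'm) option \<Rightarrow> 'n option + 'm" where
  "join_label k = (case k of None \<Rightarrow> Inl None | Some (Inl a) \<Rightarrow> Inl (Some a) | Some (Inr b) \<Rightarrow> Inr b)"

lemma join_label_simps [simp]:
  "join_label None = Inl None" "join_label (Some (Inl a)) = Inl (Some a)"
  "join_label (Some (Inr b)) = Inr b"
  by (simp_all add: join_label_def)

lemma bij_join_label: "bij (join_label :: ('n + 'm) option \<Rightarrow> 'n option + 'm)"
proof (rule bijI)
  show "inj (join_label :: ('n + 'm) option \<Rightarrow> 'n option + 'm)"
    by (rule injI) (auto simp: join_label_def split: option.splits sum.splits)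
  have "\<exists>k. x = join_label k" for x :: "'n option + 'm"
  proof (cases x)
    case (Inl j)
    then show ?thesis
      by (cases j) (auto intro: exI[of _ None] exI[of _ "Some (Inl _)"])
  next
    case (Inr b)
    then show ?thesis
      by (intro exI[of _ "Some (Inr b)"]) simp
  qed
  then show "surj (join_label :: ('n + 'm) option \<Rightarrow> 'n option + 'm)"
    by (auto simp: surj_def)
qed

lemma sum_join_label:
  fixes f :: "'n::finite option + 'm::finite \<Rightarrow> 'a::comm_monoid_add"
  shows "(\<Sum>k\<in>UNIV. f (join_label k)) = (\<Sum>j\<in>UNIV. f (Inl j)) + (\<Sum>b\<in>UNIV. f (Inr b))"
  using sum.reindex_bij_betw[OF bij_join_label, of f] by (simp add: sum_UNIV_Plus)

definition join_vertex ::
    "('n option \<Rightarrow> real ^ 'n) \<Rightarrow> ('m option \<Rightarrow> real ^ 'm) \<Rightarrow> 'm option \<Rightarrow> ('n + 'm) option \<Rightarrow> real ^ ('n + 'm)" where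
  "join_vertex v w i k =
     (case join_label k of Inl j \<Rightarrow> pair_vec (v j) (w i) | Inr b \<Rightarrow> pair_vec 0 (w (omit i b)))"

text \<open>Coefficients of a relation among the join vertices, without the common factor of the
  true weights and before division by their gcd.\<close>

definition join_weight ::
    "('n::finite option \<Rightarrow> nat) \<Rightarrow> ('m option \<Rightarrow> nat) \<Rightarrow> 'm option \<Rightarrow> ('n + 'm) option \<Rightarrow> nat" where
  "join_weight p q i k =
     (case join_label k of Inl j \<Rightarrow> q i * p j | Inr b \<Rightarrow> (\<Sum>j\<in>UNIV. p j) * q (omit i b))"

lemma det_join_vertex:
  fixes v :: "'n::finite option \<Rightarrow> real ^ 'n" and w :: "'m::finite option \<Rightarrow> real ^ 'm"
  shows "det (facet_matrix (join_vertex v w i) None) = det (facet_matrix v None) * det (facet_matrix w i)"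
proof -
  have "det (facet_matrix (join_vertex v w i) None)
      = det (\<chi> a b. facet_matrix (join_vertex v w i) None $ Inl a $ Inl b) *
        det (\<chi> a b. facet_matrix (join_vertex v w i) None $ Inr a $ Inr b)"
    by (rule det_block_triangular) (simp add: facet_matrix_def join_vertex_def omit_def)
  then show ?thesis
    by (simp add: facet_matrix_def join_vertex_def omit_def)
qed

text \<open>In the first component the relation is \<open>q i\<close> times that of
  \<open>v\<close>. In the second, \<open>w i\<close> occurs once for every \<open>v j\<close>, with
  total coefficient \<open>q i * s\<close> where \<open>s\<close> is the sum of the
  \<open>p j\<close>; scaling the other terms by \<open>s\<close> gives \<open>s\<close> times the
  relation of \<open>w\<close>.\<close>

lemma join_vertex_circuit:
  fixes v :: "'n::finite option \<Rightarrow> real ^ 'n" and w :: "'m::finite option \<Rightarrow> real ^ 'm"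
  assumes v: "positive_circuit v (\<lambda>j. real (p j))" and w: "positive_circuit w (\<lambda>k. real (q k))"
  shows "positive_circuit (join_vertex v w i) (\<lambda>k. real (join_weight p q i k))"
  unfolding positive_circuit_def
proof (intro conjI allI)
  have pos: "0 < p j" "0 < q k" for j k
    using v w by (auto simp: positive_circuit_def)
  have "0 < (\<Sum>j\<in>UNIV. p j)"
    using pos by (intro sum_pos) auto
  then show "0 < real (join_weight p q i k)" for k
    using pos by (auto simp: join_weight_def split: sum.splits)
  show "det (facet_matrix (join_vertex v w i) None) \<noteq> 0"
    using v det_facet_matrix_nonzero[OF w] by (simp add: det_join_vertex positive_circuit_def)
  define s where "s = (\<Sum>j\<in>UNIV. p j)"
  let ?f = "case_sum (\<lambda>j. real (q i * p j) *\<^sub>R pair_vec (v j) (w i))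
      (\<lambda>b. real (s * q (omit i b)) *\<^sub>R pair_vec 0 (w (omit i b)))"
  have "real (join_weight p q i k) *\<^sub>R join_vertex v w i k = ?f (join_label k)" for k
    by (simp add: join_weight_def join_vertex_def s_def split: sum.splits)
  then have "(\<Sum>k\<in>UNIV. real (join_weight p q i k) *\<^sub>R join_vertex v w i k)
      = (\<Sum>j\<in>UNIV. real (q i * p j) *\<^sub>R pair_vec (v j) (w i)) +
        (\<Sum>b\<in>UNIV. real (s * q (omit i b)) *\<^sub>R pair_vec 0 (w (omit i b)))"
    by (simp only: sum_join_label sum.case)
  also have "\<dots> = pair_vec (real (q i) *\<^sub>R (\<Sum>j\<in>UNIV. real (p j) *\<^sub>R v j))
      (real s *\<^sub>R (real (q i) *\<^sub>R w i + (\<Sum>b\<in>UNIV. real (q (omit i b)) *\<^sub>R w (omit i b))))"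
    by (simp add: pair_vec_scaleR pair_vec_sum pair_vec_add scaleR_sum_right s_def
        scaleR_add_right mult.commute sum_distrib_left sum_distrib_right flip: scaleR_sum_left)
  also have "\<dots> = 0"
    using v w sum_omit[of "\<lambda>k. real (q k) *\<^sub>R w k" i]
    by (simp add: positive_circuit_def pair_vec_zero)
  finally show "(\<Sum>k\<in>UNIV. real (join_weight p q i k) *\<^sub>R join_vertex v w i k) = 0" .
qed

lemma lattice_point_join_vertex:
  assumes "\<And>j. lattice_point (v j)" "\<And>k. lattice_point (w k)"
  shows "lattice_point (join_vertex v w i k)"
  using assms
  by (auto simp: join_vertex_def lattice_point_pair_vec lattice_point_zero split: sum.splits)

lemma origin_reflexive_simplex_join:
  fixes v :: "'n::finite option \<Rightarrow> real ^ 'n" and w :: "'m::finite option \<Rightarrow> real ^ 'm"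
  assumes v: "origin_reflexive_simplex v" and w: "origin_reflexive_simplex w"
  shows "origin_reflexive_simplex (join_vertex v w i)"
  unfolding origin_reflexive_simplex_iff
proof (intro conjI allI)
  have lat: "lattice_point (v j)" "lattice_point (w k)" for j k
    using v w by (auto simp: origin_reflexive_simplex_iff)
  show "\<exists>c. positive_circuit (join_vertex v w i) c"
    using join_vertex_circuit[OF reduced_weight_circuit[OF v] reduced_weight_circuit[OF w]] by blast
  show "lattice_point (join_vertex v w i k)" for k
    using lat by (rule lattice_point_join_vertex)
  obtain y where y: "\<And>j. lattice_point (y j)" "\<And>j l. l \<noteq> j \<Longrightarrow> y j \<bullet> v l = 1"
    using v unfolding origin_reflexive_simplex_iff by metis
  obtain z where z: "\<And>k. lattice_point (z k)" "\<And>k l. l \<noteq> k \<Longrightarrow> z k \<bullet> w l = 1"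
    using w unfolding origin_reflexive_simplex_iff by metis
  show "\<exists>x. lattice_point x \<and> (\<forall>l. l \<noteq> k \<longrightarrow> x \<bullet> join_vertex v w i l = 1)" for k
  proof (cases "join_label k")
    case (Inl j)
    \<comment> \<open>At the vertices coming from \<open>v l\<close> with
      \<open>l \<noteq> j\<close> the value is
      \<open>(1 - z i \<bullet> w i) + z i \<bullet> w i\<close>; at the others \<open>z i\<close>
      alone gives 1. The coefficient is an integer because \<open>z i\<close> and \<open>w i\<close>
      are lattice points.\<close>
    define x where "x = pair_vec ((1 - z i \<bullet> w i) *\<^sub>R y j) (z i)"
    have "lattice_point x"
      using lat y z by (auto simp: x_def lattice_point_pair_vec
          intro!: lattice_point_scaleR Ints_diff inner_lattice_points)
    moreover have "x \<bullet> join_vertex v w i l = 1" if "l \<noteq> k" for l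
    proof -
      have "join_label l \<noteq> Inl j"
        using that Inl bij_join_label by (metis bij_pointE)
      then show ?thesis
        by (auto simp: x_def join_vertex_def inner_pair_vec y z split: sum.splits)
    qed
    ultimately show ?thesis
      by blast
  next
    case (Inr b)
    \<comment> \<open>\<open>omit i b\<close> differs from \<open>i\<close>, so
      \<open>z (omit i b)\<close> takes the value 1 at \<open>w i\<close>, and with it
      \<open>x\<close> at all vertices coming from \<open>v\<close>.\<close>
    define x :: "real ^ ('n + 'm)" where "x = pair_vec 0 (z (omit i b))"
    have "lattice_point x"
      using z by (simp add: x_def lattice_point_pair_vec lattice_point_zero)
    moreover have "x \<bullet> join_vertex v w i l = 1" if "l \<noteq> k" for l
    proof -
      have "join_label l \<noteq> Inr b"
        using that Inr bij_join_label by (metis bij_pointE)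
      moreover have "omit i b' \<noteq> omit i b" if "b' \<noteq> b" for b'
        using that bij_betw_omit[of i] by (metis bij_betw_def injD)
      ultimately show ?thesis
        by (auto simp: x_def join_vertex_def inner_pair_vec z omit_neq[symmetric]
            simp del: omit_neq split: sum.splits)
    qed
    ultimately show ?thesis
      by blast
  qed
qed

text \<open>After the translation the two parts are the hulls of the points
  \<open>pair_vec (v j) (w i)\<close> and \<open>pair_vec 0 (w k)\<close>. The only one of these
  that need not be a join vertex is \<open>pair_vec 0 (w i)\<close>; it lies in the first part by
  the assumption \<open>zero\<close>.\<close>

lemma join_at_translate:
  fixes v :: "'n::finite option \<Rightarrow> real ^ 'n" and w :: "'m::finite option \<Rightarrow> real ^ 'm"
  assumes zero: "0 \<in> convex hull (range v)"
  shows "(+) (pair_vec 0 (w i)) ` join_at (w i) (convex hull (range v)) (convex hull (range w))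
    = convex hull (range (join_vertex v w i))"
proof -
  let ?f = "\<lambda>x :: real ^ 'n. pair_vec x (w i)" and ?g = "\<lambda>y :: real ^ 'm. pair_vec (0 :: real ^ 'n) y"
  let ?P = "convex hull (range v)" and ?Q = "convex hull (range w)"
  let ?U = "join_vertex v w i"
  have lin_g: "linear ?g"
    by (auto simp: linear_iff pair_vec_add pair_vec_scaleR)
  have lin_f: "linear (\<lambda>x :: real ^ 'n. pair_vec x (0 :: real ^ 'm))"
    by (auto simp: linear_iff pair_vec_add pair_vec_scaleR)
  have f_hull: "?f ` ?P = convex hull (?f ` range v)"
  proof -
    have "?f ` S = (+) (?g (w i)) ` (\<lambda>x. pair_vec x 0) ` S" for S
      by (simp add: image_image pair_vec_add)
    then show ?thesis
      by (simp only: convex_hull_linear_image[OF lin_f] convex_hull_translation)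
  qed
  have g_hull: "?g ` ?Q = convex hull (?g ` range w)"
    by (rule convex_hull_linear_image[OF lin_g])
  have "?f ` range v \<subseteq> range ?U"
  proof clarify
    fix j
    obtain k where "join_label k = (Inl j :: 'n option + 'm)"
      using bij_join_label by (metis bij_pointE)
    then have "?f (v j) = ?U k"
      by (simp add: join_vertex_def)
    then show "?f (v j) \<in> range ?U"
      by blast
  qed
  then have f_sub: "?f ` ?P \<subseteq> convex hull (range ?U)"
    unfolding f_hull by (rule hull_mono)
  have "?g ` range w \<subseteq> convex hull (range ?U)"
  proof clarify
    fix k
    show "?g (w k) \<in> convex hull (range ?U)"
    proof (cases "k = i")
      case True
      then show ?thesis
        using f_sub zero by blast
    next
      case False
      then obtain b where "k = omit i b"
        by (rule omit_cases)
      then have "?g (w k) = ?U (Some (Inr b))"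
        by (simp add: join_vertex_def)
      then show ?thesis
        by (simp add: hull_inc)
    qed
  qed
  then have g_sub: "?g ` ?Q \<subseteq> convex hull (range ?U)"
    unfolding g_hull by (rule hull_minimal) simp
  have "?U k \<in> ?f ` ?P \<union> ?g ` ?Q" for k
    by (auto simp: join_vertex_def hull_inc split: sum.splits)
  then have "range ?U \<subseteq> ?f ` ?P \<union> ?g ` ?Q"
    by blast
  then have "convex hull (range ?U) = convex hull (?f ` ?P \<union> ?g ` ?Q)"
    using f_sub g_sub by (intro subset_antisym hull_mono hull_minimal) auto
  also have "?f ` ?P \<union> ?g ` ?Q
      = (+) (pair_vec 0 (w i)) ` ((\<lambda>x. pair_vec x 0) ` ?P \<union> (\<lambda>y. pair_vec 0 (y - w i)) ` ?Q)"
    by (simp add: image_Un image_image pair_vec_add)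
  finally show ?thesis
    by (simp add: join_at_def convex_hull_translation)
qed

text \<open>Coprimality of the \<open>p j\<close> makes \<open>q i\<close> the gcd of the entries
  \<open>q i * p j\<close>, and coprimality of the \<open>q k\<close> makes \<open>s\<close> the gcd
  of all \<open>s * q k\<close>.\<close>

lemma Gcd_join_weight:
  fixes p :: "'n::finite option \<Rightarrow> nat" and q :: "'m option \<Rightarrow> nat"
  assumes p: "Gcd (range p) = 1" and q: "Gcd (range q) = 1"
  shows "Gcd (range (join_weight p q i)) = gcd (q i) (\<Sum>j\<in>UNIV. p j)"
proof (rule dvd_antisym)
  define s where "s = (\<Sum>j\<in>UNIV. p j)"
  define e where "e = Gcd (range (join_weight p q i))"
  have e: "e dvd join_weight p q i k" for k
    unfolding e_def by (rule Gcd_dvd) simp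
  have "e dvd q i * p j" for j
  proof -
    obtain k where "join_label k = (Inl j :: 'n option + 'm)"
      using bij_join_label by (metis bij_pointE)
    then show ?thesis
      using e[of k] by (simp add: join_weight_def)
  qed
  then have "e dvd Gcd (range (\<lambda>j. q i * p j))"
    by (auto intro: Gcd_greatest)
  then have e_q: "e dvd q i"
    by (simp add: Gcd_range_mult p)
  \<comment> \<open>The entry for \<open>k = i\<close> is not among the weights, but
    \<open>e_q\<close> supplies its divisibility.\<close>
  have "e dvd s * q k" for k
  proof (cases "k = i")
    case False
    then obtain b where "k = omit i b"
      by (rule omit_cases)
    then show ?thesis
      using e[of "Some (Inr b)"] by (simp add: join_weight_def s_def)
  qed (simp add: e_q)
  then have "e dvd Gcd (range (\<lambda>k. s * q k))"
    by (auto intro: Gcd_greatest)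
  then have "e dvd s"
    by (simp add: Gcd_range_mult q)
  with e_q show "Gcd (range (join_weight p q i)) dvd gcd (q i) (\<Sum>j\<in>UNIV. p j)"
    by (simp add: e_def s_def)
  show "gcd (q i) (\<Sum>j\<in>UNIV. p j) dvd Gcd (range (join_weight p q i))"
    by (rule Gcd_greatest) (auto simp: join_weight_def split: sum.splits)
qed

text \<open>Both sides are proportional to the same circuit, so the entry at \<open>None\<close>
  decides; there the block determinant gives \<open>weight v None * weight w i\<close>.\<close>

lemma weight_join_vertex:
  fixes v :: "'n::finite option \<Rightarrow> real ^ 'n" and w :: "'m::finite option \<Rightarrow> real ^ 'm"
  assumes v: "origin_reflexive_simplex v" and w: "origin_reflexive_simplex w"
  shows "weight (join_vertex v w i) k =
    weight_gcd v * weight_gcd w * join_weight (reduced_weight v) (reduced_weight w) i k"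
proof (rule weight_eqI)
  have lat: "lattice_point (v j)" "lattice_point (w k)" for j k
    using v w by (auto simp: origin_reflexive_simplex_iff)
  show lat_join: "lattice_point (join_vertex v w i k)" for k
    using lat by (rule lattice_point_join_vertex)
  show "positive_circuit (join_vertex v w i)
      (\<lambda>k. real (join_weight (reduced_weight v) (reduced_weight w) i k))"
    using v w by (intro join_vertex_circuit reduced_weight_circuit)
  have "real (weight (join_vertex v w i) None) = real (weight v None * weight w i)"
    by (simp add: real_weight[OF lat_join] real_weight[OF lat(1)] real_weight[OF lat(2)]
        det_join_vertex abs_mult)
  then have "weight (join_vertex v w i) None = weight v None * weight w i"
    by (simp only: of_nat_eq_iff)
  then show "weight (join_vertex v w i) None =
      weight_gcd v * weight_gcd w * join_weight (reduced_weight v) (reduced_weight w) i None"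
    by (simp add: join_weight_def ac_simps flip: weight_gcd_mult_reduced_weight)
qed

lemma image_mset_join_label:
  fixes f :: "'n::finite option + 'm::finite \<Rightarrow> 'a"
  shows "image_mset (\<lambda>k. f (join_label k)) (mset_set UNIV)
    = image_mset (\<lambda>j. f (Inl j)) (mset_set UNIV) + image_mset (\<lambda>b. f (Inr b)) (mset_set UNIV)"
proof -
  have "image_mset join_label (mset_set UNIV) = mset_set (UNIV :: ('n option + 'm) set)"
    by (simp add: image_mset_mset_set bij_is_inj[OF bij_join_label] bij_is_surj[OF bij_join_label])
  also have "\<dots> = mset_set (range Inl \<union> range Inr)"
    by (metis UNIV_Plus_UNIV Plus_def)
  also have "\<dots> = mset_set (range Inl) + mset_set (range Inr)"
    by (rule mset_set_Union) auto
  also have "\<dots> = image_mset Inl (mset_set UNIV) + image_mset Inr (mset_set UNIV)"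
    by (simp add: image_mset_mset_set)
  finally have "image_mset f (image_mset join_label (mset_set UNIV))
      = image_mset f (image_mset Inl (mset_set UNIV) + image_mset Inr (mset_set UNIV))"
    by simp
  then show ?thesis
    by (simp add: multiset.map_comp o_def)
qed

text \<open>Turns the labelling by \<open>omit\<close> into the index set without \<open>i\<close>,
  which expresses the omitted entry.\<close>

lemma image_mset_omit:
  fixes i :: "'m::finite option"
  shows "image_mset (\<lambda>b. f (omit i b)) (mset_set UNIV) = image_mset f (mset_set (UNIV - {i}))"
proof -
  have "image_mset (omit i) (mset_set UNIV) = mset_set (UNIV - {i})"
    using bij_betw_omit[of i] by (simp add: image_mset_mset_set bij_betw_def)
  then have "image_mset f (image_mset (omit i) (mset_set UNIV)) = image_mset f (mset_set (UNIV - {i}))"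
    by simp
  then show ?thesis
    by (simp add: multiset.map_comp o_def)
qed

theorem theorem3p2:
  fixes v :: "'n::finite option \<Rightarrow> real ^ 'n"
    and w :: "'m::finite option \<Rightarrow> real ^ 'm"
    and p :: "'n option \<Rightarrow> nat" and q :: "'m option \<Rightarrow> nat"
    and lam mu s d :: nat and i :: "'m option"
    and P :: "(real ^ 'n) set" and Q :: "(real ^ 'm) set"
  assumes "P = convex hull (range v)" and "origin_reflexive_simplex v"
    and "p = reduced_weight v" and "lam = weight_gcd v"
    and "Q = convex hull (range w)" and "origin_reflexive_simplex w"
    and "q = reduced_weight w" and "mu = weight_gcd w"
    and "s = (\<Sum>j\<in>UNIV. p j)" and "d = gcd (q i) s"
  shows "reflexive (join_at (w i) P Q) \<and>
    int CARD('n + 'm) simplex join_at (w i) P Q \<and>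
    has_type (join_at (w i) P Q)
      (image_mset (\<lambda>j. q i * p j div d) (mset_set UNIV) +
       image_mset (\<lambda>k. s * q k div d) (mset_set (UNIV - {i})))
      (lam * mu * d)"
proof -
  let ?U = "join_vertex v w i" and ?J = "join_at (w i) P Q"
  \<comment> \<open>Translating by \<open>t\<close> puts an interior lattice point of the join at
    the origin, as \<open>reflexive\<close> and \<open>has_type\<close> require.\<close>
  define t :: "real ^ ('n + 'm)" where "t = pair_vec 0 (w i)"
  have U: "origin_reflexive_simplex ?U"
    using assms by (intro origin_reflexive_simplex_join)
  then have inj: "inj ?U" and ind: "\<not> affine_dependent (range ?U)"
    and refl: "origin_reflexive (convex hull (range ?U))"
    by (auto simp: origin_reflexive_simplex_def)
  have lat_t: "lattice_point t"
    using assms by (simp add: t_def lattice_point_pair_vec lattice_point_zero origin_reflexive_simplex_iff)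
  have "0 \<in> convex hull (range v)"
    using assms interior_subset by (auto simp: origin_reflexive_simplex_def origin_reflexive_def)
  then have J: "(+) t ` ?J = convex hull (range ?U)"
    unfolding t_def assms by (rule join_at_translate)
  have "reflexive ?J"
    using lat_t J refl by (auto simp: reflexive_def)
  moreover have "int CARD('n + 'm) simplex ?J"
    unfolding simplex_def
  proof (intro exI conjI)
    \<comment> \<open>\<open>simplex\<close> concerns the join itself, so the vertices are moved
      back by \<open>- t\<close>.\<close>
    let ?C = "(+) (- t) ` range ?U"
    show "\<not> affine_dependent ?C"
      using ind affine_dependent_translation_eq by blast
    show "int (card ?C) = int CARD('n + 'm) + 1"
      using inj by (simp add: card_image)
    have "?J = (+) (- t) ` (+) t ` ?J"
      by (simp add: image_image)
    then show "?J = convex hull ?C"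
      by (simp only: J convex_hull_translation)
  qed
  moreover have "has_type ?J
      (image_mset (\<lambda>j. q i * p j div d) (mset_set UNIV) +
       image_mset (\<lambda>k. s * q k div d) (mset_set (UNIV - {i}))) (lam * mu * d)"
    unfolding has_type_def
  proof (intro exI conjI)
    have weight_U: "weight ?U k = lam * mu * join_weight p q i k" for k
      using assms by (simp add: weight_join_vertex)
    have "Gcd (range (join_weight p q i)) = d"
      using assms by (simp add: Gcd_join_weight Gcd_reduced_weight)
    then show gcd_U: "lam * mu * d = weight_gcd ?U"
      by (simp add: weight_gcd_def weight_U Gcd_range_mult)
    \<comment> \<open>Positivity lets the common factor cancel inside \<open>div\<close>.\<close>
    have "0 < lam * mu"
      using assms by (simp add: weight_gcd_pos)
    then have "reduced_weight ?U k = join_weight p q i k div d" for k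
      unfolding reduced_weight_def weight_U gcd_U[symmetric] by (intro div_mult_mult1) simp
    then have "reduced_weight ?U = (\<lambda>k. case_sum (\<lambda>j. q i * p j div d)
        (\<lambda>b. s * q (omit i b) div d) (join_label k))"
      by (auto simp: fun_eq_iff join_weight_def assms(9) split: sum.splits)
    then show "image_mset (\<lambda>j. q i * p j div d) (mset_set UNIV) +
          image_mset (\<lambda>k. s * q k div d) (mset_set (UNIV - {i}))
        = image_mset (reduced_weight ?U) (mset_set UNIV)"
      by (simp only: image_mset_join_label sum.case image_mset_omit[of "\<lambda>k. s * q k div d" i])
  qed (fact lat_t J U)+
  ultimately show ?thesis
    by blast
qed

end
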